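(* Let $H$ be a real Hilbert space with inner product $\langle\cdot,\cdot\rangle$, let $(H_n)_n$ be an increasing sequence of finite-dimensional subspaces of $H$, $\mathrm{Loc}=\bigcup_nH_n$, and let $\langle\cdot,\cdot\rangle_n$ be an inner product on $H_n$ such that $\lim_n\langle f,g\rangle_n=\langle f,g\rangle$ for all $f,g\in\mathrm{Loc}$. Let $L:D(L)\subseteq H\to H$ be a densely defined positive closed operator such that $\mathrm{Loc}$ is a kernel for $L$ and for its adjoint $L^*$, and let $(L_n)_n$ be a finite approximation of $L$. Let $S_0:D(S_0)\subseteq H\to H$ be a symmetric positive operator such that $\mathrm{Loc}$ is a kernel for $S_0$ and $\langle g,S_0g\rangle\le\langle g,Lg\rangle$ for all $g \in D(L)\cap D(S_0)$. Let $(S_{0,n})_n$ be a finite approximation of $S_0$ such that $\langle f,S_{0,n}f\rangle_n\le\langle f,L_nf\rangle_n$ for all $f\in H_n$. Let $h,h'\in\mathrm{Loc}\cap\mathcal{H}_{-1}$ with $h$ in the closure of $\mathrm{Im}(L)\cap\mathcal{H}_{-1}$ under $\|\cdot\|_{-1}$. Assume that: (A) for each $\varepsilon>0$ there exists $g_\varepsilon\in\mathrm{Loc}$ such that $\|h-Lg_\varepsilon\|_{0,-1}<\varepsilon$; (B) $\|h'\|_{0,-1}<\infty$, $\lim_{n\to\infty}\|h'\|_{0,-1,n}=\|h'\|_{0,-1}$, and, for $u_\varepsilon=h-Lg_\varepsilon$, $\lim_{n\to\infty}\|u_\varepsilon\|_{0,-1,n}=\|u_\varepsilon\|_{0,-1}$.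 Then $$\lim_{n\to\infty}\langle h',L_n^{-1}h\rangle_n=\langle h',L^{-1}h\rangle.$$
   Context: An operator $A:D(A)\subseteq H\to H$ (not necessarily bounded) is positive if $\langle g,Ag\rangle>0$ for all $g\in D(A)\setminus\{0\}$. $\mathrm{Loc}$ is a kernel (core) for $A$ if $\mathrm{Loc}\subseteq D(A)$ and the closure of $A|_{\mathrm{Loc}}$ is $A$. A sequence $(A_n)_n$ is a finite approximation of a positive operator $A$ if: (i) $A_n:H_n\to H_n$ is linear; (ii) $\langle f,A_nf\rangle_n>0$ for $f\in H_n\setminus\{0\}$; (iii) for every $f\in\mathrm{Loc}$ there is $n_0$ with $A_nf=Af$ for all $n\ge n_0$; (iv) if $A$ is symmetric then each $A_n$ is symmetric with respect to $\langle\cdot,\cdot\rangle_n$. In particular each $A_n$ is invertible. Sobolev norms of $L$: for $f\in D(L)$, $\|f\|_1^2=\langle f,Lf\rangle$, and $\mathcal{H}_1$ is the completion of $D(L)$ under $\|\cdot\|_1$. For $g\in H$, $\|g\|_{-1}^2=\sup_{f\in D(L)}\{2\langle g,f\rangle-\langle f,Lf\rangle\}$, and $\mathcal{H}_{-1}$ is the completion of $\{g\in H:\|g\|_{-1}<\infty\}$ under $\|\cdot\|_{-1}$. Since $|\langle f,g\rangle|\le\|f\|_1\|g\|_{-1}$, the inner product extends to a continuous bilinear form $\mathcal{H}_{-1}\times\mathcal{H}_1\to\mathbb{R}$. Since $\|f\|_1\le\|Lf\|_{-1}$, the operator $L^{-1}:\mathrm{Im}(L)\cap\mathcal{H}_{-1}\to\mathcal{H}_1$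 is bounded and extends continuously to the closure of $\mathrm{Im}(L)\cap\mathcal{H}_{-1}$ under $\|\cdot\|_{-1}$; $\langle h',L^{-1}h\rangle$ is understood in this extended sense. Norms of $S_0$ and $S_{0,n}$: $\|g\|_{0,-1}^2=\sup_{f\in D(S_0)}\{2\langle g,f\rangle-\langle f,S_0f\rangle\}$ for $g\in H$, and $\|g\|_{0,-1,n}^2=\sup_{f\in H_n}\{2\langle g,f\rangle_n-\langle f,S_{0,n}f\rangle_n\}$ for $g\in H_n$. Expressions such as $\|h'\|_{0,-1,n}$, $\|u_\varepsilon\|_{0,-1,n}$, $\langle h',L_n^{-1}h\rangle_n$ are well defined for $n$ large, since an element of $\mathrm{Loc}$ belongs to $H_n$ for all large $n$ and $Lg_\varepsilon=L_ng_\varepsilon\in H_n$ for all large $n$. *)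

theory Defs
  imports "HOL-Analysis.Analysis"
begin

section \<open>Unbounded operators\<close>

text \<open>
  An operator \<open>A : D(A) \<subseteq> H \<rightarrow> H\<close> is given by its domain \<open>D\<close> and a total function \<open>A\<close>, of which
  only the values on \<open>D\<close> are used.
\<close>

definition linear_operator :: "'a::real_vector set \<Rightarrow> ('a \<Rightarrow> 'a) \<Rightarrow> bool" where
  "linear_operator D A \<longleftrightarrow> subspace D \<and>
     (\<forall>f\<in>D. \<forall>g\<in>D. A (f + g) = A f + A g) \<and> (\<forall>c. \<forall>f\<in>D. A (c *\<^sub>R f) = c *\<^sub>R A f)"

definition op_graph :: "'a set \<Rightarrow> ('a \<Rightarrow> 'a) \<Rightarrow> ('a \<times> 'a) set" where
  "op_graph D A = (\<lambda>f. (f, A f)) ` D"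

definition densely_defined :: "'a::real_inner set \<Rightarrow> bool" where
  "densely_defined D \<longleftrightarrow> closure D = UNIV"

definition closed_operator :: "'a::real_inner set \<Rightarrow> ('a \<Rightarrow> 'a) \<Rightarrow> bool" where
  "closed_operator D A \<longleftrightarrow> closed (op_graph D A)"

definition positive_operator :: "'a::real_inner set \<Rightarrow> ('a \<Rightarrow> 'a) \<Rightarrow> bool" where
  "positive_operator D A \<longleftrightarrow> (\<forall>g\<in>D - {0}. g \<bullet> A g > 0)"

definition symmetric_operator :: "'a::real_inner set \<Rightarrow> ('a \<Rightarrow> 'a) \<Rightarrow> bool" where
  "symmetric_operator D A \<longleftrightarrow> (\<forall>f\<in>D. \<forall>g\<in>D. A f \<bullet> g = f \<bullet> A g)"

definition adjoint_dom :: "'a::real_inner set \<Rightarrow> ('a \<Rightarrow> 'a) \<Rightarrow> 'a set" where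
  "adjoint_dom D A = {g. \<exists>k. \<forall>f\<in>D. A f \<bullet> g = f \<bullet> k}"

text \<open>The vector \<open>k\<close> below is unique when \<open>D\<close> is dense.\<close>

definition adjoint_op :: "'a::real_inner set \<Rightarrow> ('a \<Rightarrow> 'a) \<Rightarrow> 'a \<Rightarrow> 'a" where
  "adjoint_op D A g = (THE k. \<forall>f\<in>D. A f \<bullet> g = f \<bullet> k)"

definition is_core :: "'a::real_inner set \<Rightarrow> 'a set \<Rightarrow> ('a \<Rightarrow> 'a) \<Rightarrow> bool" where
  "is_core C D A \<longleftrightarrow> C \<subseteq> D \<and> closure (op_graph C A) = op_graph D A"


section \<open>Finite-dimensional approximation\<close>

definition finite_dim_subspace :: "'a::real_vector set \<Rightarrow> bool" where
  "finite_dim_subspace V \<longleftrightarrow> (\<exists>B. finite B \<and> V = span B)"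

definition inner_product_on :: "'a::real_vector set \<Rightarrow> ('a \<Rightarrow> 'a \<Rightarrow> real) \<Rightarrow> bool" where
  "inner_product_on V ip \<longleftrightarrow>
     (\<forall>f\<in>V. \<forall>g\<in>V. ip f g = ip g f) \<and>
     (\<forall>f\<in>V. \<forall>g\<in>V. \<forall>k\<in>V. ip (f + g) k = ip f k + ip g k) \<and>
     (\<forall>c. \<forall>f\<in>V. \<forall>g\<in>V. ip (c *\<^sub>R f) g = c * ip f g) \<and>
     (\<forall>f\<in>V - {0}. ip f f > 0)"

definition Loc :: "(nat \<Rightarrow> 'a set) \<Rightarrow> 'a set" where
  "Loc H = (\<Union>n. H n)"

definition finite_approximation ::
  "(nat \<Rightarrow> 'a::real_inner set) \<Rightarrow> (nat \<Rightarrow> 'a \<Rightarrow> 'a \<Rightarrow> real) \<Rightarrow>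
   'a set \<Rightarrow> ('a \<Rightarrow> 'a) \<Rightarrow> (nat \<Rightarrow> 'a \<Rightarrow> 'a) \<Rightarrow> bool" where
  "finite_approximation H ip D A An \<longleftrightarrow>
     (\<forall>n. linear_operator (H n) (An n) \<and> An n ` H n \<subseteq> H n) \<and>
     (\<forall>n. \<forall>f\<in>H n - {0}. ip n f (An n f) > 0) \<and>
     (\<forall>f\<in>Loc H. \<exists>n0. \<forall>n\<ge>n0. f \<in> H n \<and> An n f = A f) \<and>
     (symmetric_operator D A \<longrightarrow>
        (\<forall>n. \<forall>f\<in>H n. \<forall>g\<in>H n. ip n (An n f) g = ip n f (An n g)))"


section \<open>Sobolev norms\<close>

definition norm_1 :: "'a::real_inner set \<Rightarrow> ('a \<Rightarrow> 'a) \<Rightarrow> 'a \<Rightarrow> real" where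
  "norm_1 D A f = sqrt (f \<bullet> A f)"

text \<open>
  The dual norm may be infinite. It is defined for an arbitrary inner product \<open>ip\<close> so as to cover
  both an operator on \<open>H\<close> and its approximations on the spaces \<open>H\<^sub>n\<close>. The supremum is nonnegative,
  since \<open>f = 0\<close> contributes \<open>0\<close>.
\<close>

definition dual_norm_sq ::
  "('a \<Rightarrow> 'a \<Rightarrow> real) \<Rightarrow> 'a set \<Rightarrow> ('a \<Rightarrow> 'a) \<Rightarrow> 'a \<Rightarrow> ereal" where
  "dual_norm_sq ip D A g = (SUP f\<in>D. ereal (2 * ip g f - ip f (A f)))"

definition dual_norm ::
  "('a \<Rightarrow> 'a \<Rightarrow> real) \<Rightarrow> 'a set \<Rightarrow> ('a \<Rightarrow> 'a) \<Rightarrow> 'a \<Rightarrow> ereal" where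
  "dual_norm ip D A g =
     (if dual_norm_sq ip D A g = \<infinity> then \<infinity>
      else ereal (sqrt (real_of_ereal (dual_norm_sq ip D A g))))"

definition finite_dual :: "'a::real_inner set \<Rightarrow> ('a \<Rightarrow> 'a) \<Rightarrow> 'a set" where
  "finite_dual D A = {g. dual_norm (\<bullet>) D A g < \<infinity>}"

definition norm_m1 :: "'a::real_inner set \<Rightarrow> ('a \<Rightarrow> 'a) \<Rightarrow> 'a \<Rightarrow> real" where
  "norm_m1 D A g = real_of_ereal (dual_norm (\<bullet>) D A g)"


section \<open>Completions\<close>

text \<open>
  The completion of a space \<open>S\<close> under a norm \<open>N\<close> on \<open>S\<close>: equivalence classes of \<open>N\<close>-Cauchy sequences
  in \<open>S\<close>, two sequences being equivalent if their difference is \<open>N\<close>-null. The norm depends on an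
  operator, hence the completion is a set of classes rather than a type.
\<close>

definition cauchy_seqs :: "('a::real_vector \<Rightarrow> real) \<Rightarrow> 'a set \<Rightarrow> (nat \<Rightarrow> 'a) set" where
  "cauchy_seqs N S = {x. range x \<subseteq> S \<and> (\<forall>e>0. \<exists>M. \<forall>m\<ge>M. \<forall>n\<ge>M. N (x m - x n) < e)}"

definition completion_rel ::
  "('a::real_vector \<Rightarrow> real) \<Rightarrow> 'a set \<Rightarrow> ((nat \<Rightarrow> 'a) \<times> (nat \<Rightarrow> 'a)) set" where
  "completion_rel N S = {(x, y). x \<in> cauchy_seqs N S \<and> y \<in> cauchy_seqs N S \<and>
     (\<lambda>k. N (x k - y k)) \<longlonglongrightarrow> 0}"

definition completion :: "('a::real_vector \<Rightarrow> real) \<Rightarrow> 'a set \<Rightarrow> (nat \<Rightarrow> 'a) set set" where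
  "completion N S = cauchy_seqs N S // completion_rel N S"

definition completion_embed ::
  "('a::real_vector \<Rightarrow> real) \<Rightarrow> 'a set \<Rightarrow> 'a \<Rightarrow> (nat \<Rightarrow> 'a) set" where
  "completion_embed N S a = completion_rel N S `` {\<lambda>_. a}"

text \<open>
  The extension by continuity of a real function of two variables to a pair of completions, when the
  limit exists and does not depend on the representing sequences.
\<close>

definition completion_lift2 ::
  "('a \<Rightarrow> 'a \<Rightarrow> real) \<Rightarrow> (nat \<Rightarrow> 'a) set \<Rightarrow> (nat \<Rightarrow> 'a) set \<Rightarrow> real" where
  "completion_lift2 F X Y = (THE c. \<forall>x\<in>X. \<forall>y\<in>Y. (\<lambda>k. F (x k) (y k)) \<longlonglongrightarrow> c)"

definition completion_dist ::
  "('a::real_vector \<Rightarrow> real) \<Rightarrow> (nat \<Rightarrow> 'a) set \<Rightarrow> (nat \<Rightarrow> 'a) set \<Rightarrow> real" where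
  "completion_dist N = completion_lift2 (\<lambda>x y. N (x - y))"


section \<open>The Sobolev spaces and the extended inverse\<close>

definition H1 :: "'a::real_inner set \<Rightarrow> ('a \<Rightarrow> 'a) \<Rightarrow> (nat \<Rightarrow> 'a) set set" where
  "H1 D A = completion (norm_1 D A) D"

definition emb1 :: "'a::real_inner set \<Rightarrow> ('a \<Rightarrow> 'a) \<Rightarrow> 'a \<Rightarrow> (nat \<Rightarrow> 'a) set" where
  "emb1 D A = completion_embed (norm_1 D A) D"

definition dist1 ::
  "'a::real_inner set \<Rightarrow> ('a \<Rightarrow> 'a) \<Rightarrow> (nat \<Rightarrow> 'a) set \<Rightarrow> (nat \<Rightarrow> 'a) set \<Rightarrow> real" where
  "dist1 D A = completion_dist (norm_1 D A)"

definition Hm1 :: "'a::real_inner set \<Rightarrow> ('a \<Rightarrow> 'a) \<Rightarrow> (nat \<Rightarrow> 'a) set set" where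
  "Hm1 D A = completion (norm_m1 D A) (finite_dual D A)"

definition embm1 :: "'a::real_inner set \<Rightarrow> ('a \<Rightarrow> 'a) \<Rightarrow> 'a \<Rightarrow> (nat \<Rightarrow> 'a) set" where
  "embm1 D A = completion_embed (norm_m1 D A) (finite_dual D A)"

definition distm1 ::
  "'a::real_inner set \<Rightarrow> ('a \<Rightarrow> 'a) \<Rightarrow> (nat \<Rightarrow> 'a) set \<Rightarrow> (nat \<Rightarrow> 'a) set \<Rightarrow> real" where
  "distm1 D A = completion_dist (norm_m1 D A)"

text \<open>The pairing of \<open>\<H>\<^sub>-\<^sub>1\<close> (first argument) with \<open>\<H>\<^sub>1\<close> (second argument) extending the inner product.\<close>

definition pairing :: "(nat \<Rightarrow> 'a::real_inner) set \<Rightarrow> (nat \<Rightarrow> 'a) set \<Rightarrow> real" where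
  "pairing = completion_lift2 (\<bullet>)"

definition image_closure :: "'a::real_inner set \<Rightarrow> ('a \<Rightarrow> 'a) \<Rightarrow> (nat \<Rightarrow> 'a) set set" where
  "image_closure D A =
     {X \<in> Hm1 D A. \<forall>e>0. \<exists>g \<in> A ` D \<inter> finite_dual D A. distm1 D A (embm1 D A g) X < e}"

text \<open>
  The continuous extension of \<open>A\<^sup>-\<^sup>1\<close> to \<open>image_closure D A\<close>: the element \<open>Y\<close> of \<open>\<H>\<^sub>1\<close> to which \<open>f\<^sub>k\<close>
  converges whenever \<open>A f\<^sub>k \<in> \<H>\<^sub>-\<^sub>1\<close> converges to \<open>X\<close> in \<open>\<H>\<^sub>-\<^sub>1\<close>.
\<close>

definition ext_inverse ::
  "'a::real_inner set \<Rightarrow> ('a \<Rightarrow> 'a) \<Rightarrow> (nat \<Rightarrow> 'a) set \<Rightarrow> (nat \<Rightarrow> 'a) set" where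
  "ext_inverse D A X = (THE Y. Y \<in> H1 D A \<and>
     (\<forall>f. (\<forall>k. f k \<in> D \<and> A (f k) \<in> finite_dual D A) \<and>
          (\<lambda>k. distm1 D A (embm1 D A (A (f k))) X) \<longlonglongrightarrow> 0 \<longrightarrow>
          (\<lambda>k. dist1 D A (emb1 D A (f k)) Y) \<longlonglongrightarrow> 0))"

end

theory Submission
  imports Defs
begin

text \<open>
  For small \<open>\<epsilon>\<close>, both \<open>\<langle>h', L\<^sub>n\<^sup>-\<^sup>1 h\<rangle>\<^sub>n\<close> with \<open>n\<close> large and \<open>\<langle>h', L\<^sup>-\<^sup>1 h\<rangle>\<close> are close to \<open>\<langle>h', g\<^sub>\<epsilon>\<rangle>\<close>.

  On the finite-dimensional side this is an energy estimate. If \<open>S \<le> A\<close> as quadratic forms and \<open>w\<close> lies in the domain, then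
  \<open>\<langle>w, A w\<rangle> \<le> \<parallel>A w\<parallel> \<langle>w, S w\<rangle>\<^sup>1\<^sup>/\<^sup>2 \<le> \<parallel>A w\<parallel> \<langle>w, A w\<rangle>\<^sup>1\<^sup>/\<^sup>2\<close> with the norm dual to \<open>S\<close>, and hence
  \<open>\<bar>\<langle>h', w\<rangle>\<bar> \<le> \<parallel>h'\<parallel> \<parallel>A w\<parallel>\<close> (lemma \<open>energy_estimate\<close>). For \<open>A = L\<^sub>n\<close>, \<open>S = S\<^sub>0\<^sub>,\<^sub>n\<close> and
  \<open>w = L\<^sub>n\<^sup>-\<^sup>1 h - g\<^sub>\<epsilon>\<close> one has \<open>A w = h - L g\<^sub>\<epsilon> = u\<^sub>\<epsilon>\<close> once \<open>n\<close> is large, so that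
  \<open>\<langle>h', L\<^sub>n\<^sup>-\<^sup>1 h\<rangle>\<^sub>n\<close> differs from \<open>\<langle>h', g\<^sub>\<epsilon>\<rangle>\<^sub>n\<close> by at most the product of the norms of \<open>h'\<close> and \<open>u\<^sub>\<epsilon>\<close> dual
  to \<open>S\<^sub>0\<^sub>,\<^sub>n\<close>. The convergence of these norms bounds the product by a constant times \<open>\<epsilon>\<close>, uniformly in
  large \<open>n\<close>.

  On the side of the limit, \<open>S\<^sub>0 \<le> L\<close> on the core of \<open>L\<close> makes the norm dual to \<open>L\<close> smaller than the
  norm dual to \<open>S\<^sub>0\<close> (lemma \<open>dual_norm_antimono_core\<close>). Thus \<open>L g\<^sub>\<epsilon> \<rightarrow> h\<close> in \<open>\<H>\<^sub>-\<^sub>1\<close>, and \<open>\<parallel>f\<parallel>\<^sub>1 \<le> \<parallel>L f\<parallel>\<^sub>-\<^sub>1\<close>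
  makes \<open>g\<^sub>\<epsilon>\<close> a Cauchy family in \<open>\<H>\<^sub>1\<close> whose limit is the extended inverse of \<open>h\<close> (lemma
  \<open>ext_inverse_eq_class\<close>). Continuity of the pairing gives \<open>\<langle>h', g\<^sub>\<epsilon>\<rangle> \<rightarrow> \<langle>h', L\<^sup>-\<^sup>1 h\<rangle>\<close>, and the two
  limits \<open>n \<rightarrow> \<infinity>\<close> and \<open>\<epsilon> \<rightarrow> 0\<close> may be combined.
\<close>


section \<open>Injective operators on finite-dimensional spaces\<close>

text \<open>
  An operator that is linear only on \<open>V\<close> is replaced by a linear map on the whole space with the
  same values on a basis \<open>B\<close> of \<open>V\<close>. The image of \<open>B\<close> is independent with as many elements as \<open>B\<close>, so
  a vector of \<open>V\<close> outside its span would give an independent subset of \<open>V\<close> that is too large.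
\<close>

lemma injective_endomorphism_surjective:
  fixes V :: "'a::real_vector set"
  assumes fin: "finite_dim_subspace V" and lin: "linear_operator V A"
    and into: "A ` V \<subseteq> V" and ker: "\<And>x. x \<in> V \<Longrightarrow> A x = 0 \<Longrightarrow> x = 0"
  shows "A ` V = V"
proof -
  obtain B0 where B0: "finite B0" "V = span B0"
    using fin unfolding finite_dim_subspace_def by auto
  obtain B where B: "B \<subseteq> B0" "independent B" "B0 \<subseteq> span B"
    using maximal_independent_subset[of B0] by blast
  have finB: "finite B" using B(1) B0(1) finite_subset by blast
  have V: "V = span B"
    unfolding B0(2)
    by (rule subset_antisym[OF span_minimal[OF B(3) subspace_span] span_mono[OF B(1)]])
  obtain T where T: "linear T" "\<And>x. x \<in> B \<Longrightarrow> T x = A x"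
    using linear_independent_extend[OF B(2), of A] by auto
  have add: "A (x + y) = A x + A y" if "x \<in> V" "y \<in> V" for x y
    using lin that unfolding linear_operator_def by blast
  have scale: "A (c *\<^sub>R x) = c *\<^sub>R A x" if "x \<in> V" for c x
    using lin that unfolding linear_operator_def by blast
  have sub: "subspace V" unfolding V by (rule subspace_span)
  have T_eq: "T x = A x" if "x \<in> V" for x
  proof -
    have A0: "A 0 = 0" using scale[OF subspace_0[OF sub], of 0] by simp
    have "x \<in> span B" using that V by simp
    then have "x \<in> V \<and> T x = A x"
    proof (induction rule: span_induct_alt)
      case base
      show ?case using A0 linear_0[OF T(1)] subspace_0[OF sub] by simp
    next
      case (step c x y)
      have xV: "x \<in> V" unfolding V using step(1) by (rule span_base)
      have yV: "y \<in> V" and Ty: "T y = A y" using step(2) by auto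
      have cV: "c *\<^sub>R x \<in> V" using sub xV by (simp add: subspace_scale)
      have "T (c *\<^sub>R x + y) = A (c *\<^sub>R x + y)"
        unfolding linear_add[OF T(1)] linear_scale[OF T(1)] add[OF cV yV] scale[OF xV] Ty
          T(2)[OF step(1)] ..
      then show ?case using subspace_add[OF sub cV yV] by blast
    qed
    then show ?thesis by simp
  qed
  have inj: "inj_on T (span B)"
  proof (rule inj_onI)
    fix x y assume x: "x \<in> span B" and y: "y \<in> span B" and eq: "T x = T y"
    have m: "x - y \<in> V" unfolding V using x y by (rule span_diff)
    have "A (x - y) = 0"
      unfolding T_eq[OF m, symmetric] linear_diff[OF T(1)] eq by (rule diff_self)
    from ker[OF m this] show "x = y" by (rule eq_iff_diff_eq_0[THEN iffD2])
  qed
  have ind: "independent (T ` B)"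
    using linear_independent_injective_image[OF T(1) B(2) inj] .
  have card: "card (T ` B) = card B"
    by (rule card_image[OF inj_on_subset[OF inj span_superset]])
  have TB: "T ` B \<subseteq> span B"
  proof
    fix y assume "y \<in> T ` B"
    then obtain x where x: "x \<in> B" "y = A x" using T(2) by auto
    have "x \<in> V" unfolding V using x(1) by (rule span_base)
    then show "y \<in> span B" using into x(2) V by auto
  qed
  have "span B \<subseteq> span (T ` B)"
  proof
    fix b assume b: "b \<in> span B"
    show "b \<in> span (T ` B)"
    proof (rule ccontr)
      assume nb: "b \<notin> span (T ` B)"
      have "independent (insert b (T ` B))"
        by (rule independent_insertI[OF nb ind])
      moreover have "insert b (T ` B) \<subseteq> span B" using b TB by auto
      ultimately have "card (insert b (T ` B)) \<le> card B"
        using independent_span_bound[OF finB] by blast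
      moreover have "b \<notin> T ` B" using nb by (blast intro: span_base)
      then have "card (insert b (T ` B)) = Suc (card B)"
        using card_insert_disjoint[OF finite_imageI[OF finB]] card by metis
      ultimately show False by simp
    qed
  qed
  also have "span (T ` B) = T ` V" unfolding V by (rule linear_span_image[OF T(1)])
  also have "\<dots> = A ` V" using T_eq by (rule image_cong[OF refl])
  finally show ?thesis using into unfolding V[symmetric] by blast
qed


section \<open>Positive forms and their dual norms\<close>

text \<open>
  The ambient space \<open>W\<close> and its inner product are parameters, so that both the operators on the whole
  Hilbert space and the operators on the spaces \<open>H\<^sub>n\<close> are instances.
\<close>

locale positive_form =
  fixes W :: "'a::real_vector set" and ip :: "'a \<Rightarrow> 'a \<Rightarrow> real"
    and D :: "'a set" and A :: "'a \<Rightarrow> 'a"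
  assumes inner: "inner_product_on W ip"
    and subspace_W: "subspace W"
    and dom: "D \<subseteq> W"
    and lin: "linear_operator D A"
    and image: "A ` D \<subseteq> W"
    and pos: "\<And>f. f \<in> D \<Longrightarrow> f \<noteq> 0 \<Longrightarrow> ip f (A f) > 0"
begin

lemma subspace_D: "subspace D"
  using lin unfolding linear_operator_def by blast

lemma A_add: "f \<in> D \<Longrightarrow> k \<in> D \<Longrightarrow> A (f + k) = A f + A k"
  using lin unfolding linear_operator_def by blast

lemma A_scale: "f \<in> D \<Longrightarrow> A (c *\<^sub>R f) = c *\<^sub>R A f"
  using lin unfolding linear_operator_def by blast

lemma A_diff: "f \<in> D \<Longrightarrow> k \<in> D \<Longrightarrow> A (f - k) = A f - A k"
  using A_add[of f "(-1) *\<^sub>R k"] A_scale[of k "-1"] subspace_scale[OF subspace_D, of k "-1"] by simp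

lemma ip_commute: "f \<in> W \<Longrightarrow> k \<in> W \<Longrightarrow> ip f k = ip k f"
  using inner unfolding inner_product_on_def by blast

lemma ip_add_left: "f \<in> W \<Longrightarrow> k \<in> W \<Longrightarrow> l \<in> W \<Longrightarrow> ip (f + k) l = ip f l + ip k l"
  using inner unfolding inner_product_on_def by blast

lemma ip_scale_left: "f \<in> W \<Longrightarrow> k \<in> W \<Longrightarrow> ip (c *\<^sub>R f) k = c * ip f k"
  using inner unfolding inner_product_on_def by blast

lemma ip_add_right:
  assumes "f \<in> W" "k \<in> W" "l \<in> W"
  shows "ip l (f + k) = ip l f + ip l k"
  unfolding ip_commute[OF assms(3,1)] ip_commute[OF assms(3,2)] ip_add_left[OF assms, symmetric]
  by (rule ip_commute[OF assms(3) subspace_add[OF subspace_W assms(1,2)]])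

lemma ip_scale_right:
  assumes "f \<in> W" "k \<in> W"
  shows "ip k (c *\<^sub>R f) = c * ip k f"
  unfolding ip_commute[OF assms(2,1)] ip_scale_left[OF assms, symmetric]
  by (rule ip_commute[OF assms(2) subspace_scale[OF subspace_W assms(1)]])

lemma energy_scale:
  assumes f: "f \<in> D"
  shows "ip (c *\<^sub>R f) (A (c *\<^sub>R f)) = c\<^sup>2 * ip f (A f)"
proof -
  have W: "f \<in> W" "A f \<in> W" using f dom image by auto
  have "ip (c *\<^sub>R f) (A (c *\<^sub>R f)) = c * ip f (c *\<^sub>R A f)"
    unfolding A_scale[OF f] by (rule ip_scale_left[OF W(1) subspace_scale[OF subspace_W W(2)]])
  also have "\<dots> = c * (c * ip f (A f))" unfolding ip_scale_right[OF W(2,1)] ..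
  finally show ?thesis by (simp add: power2_eq_square)
qed

lemma energy_zero: "ip 0 (A 0) = 0"
  using energy_scale[OF subspace_0[OF subspace_D], of 0] by simp

lemma energy_nonneg: "f \<in> D \<Longrightarrow> ip f (A f) \<ge> 0"
  using pos[of f] energy_zero by (cases "f = 0") auto

lemma dual_norm_sq_nonneg: "g \<in> W \<Longrightarrow> dual_norm_sq ip D A g \<ge> 0"
proof -
  assume g: "g \<in> W"
  have "ip g 0 = 0"
    using ip_scale_right[OF subspace_0[OF subspace_W] g, of 0] by simp
  then have "ereal 0 = ereal (2 * ip g 0 - ip 0 (A 0))" using energy_zero by simp
  also have "\<dots> \<le> dual_norm_sq ip D A g"
    unfolding dual_norm_sq_def by (rule SUP_upper[OF subspace_0[OF subspace_D]])
  finally show ?thesis by (simp add: zero_ereal_def)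
qed

lemma dual_norm_nonneg: "g \<in> W \<Longrightarrow> dual_norm ip D A g \<ge> 0"
  using dual_norm_sq_nonneg[of g] unfolding dual_norm_def
  by (auto simp: real_of_ereal_pos)

lemma dual_norm_le_iff_sq:
  assumes g: "g \<in> W" and C: "C \<ge> 0"
  shows "dual_norm ip D A g \<le> ereal C \<longleftrightarrow> (\<forall>f\<in>D. 2 * ip g f - ip f (A f) \<le> C\<^sup>2)"
proof -
  have "dual_norm ip D A g \<le> ereal C \<longleftrightarrow> dual_norm_sq ip D A g \<le> ereal (C\<^sup>2)"
  proof (cases "dual_norm_sq ip D A g")
    case (real r)
    then have "r \<ge> 0" using dual_norm_sq_nonneg[OF g] by simp
    then have "sqrt r \<le> C \<longleftrightarrow> r \<le> C\<^sup>2"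
      using C by (metis real_le_lsqrt real_sqrt_le_iff real_sqrt_unique sqrt_le_D)
    then show ?thesis using real by (simp add: dual_norm_def)
  next
    case PInf
    then show ?thesis by (simp add: dual_norm_def)
  next
    case MInf
    then show ?thesis using dual_norm_sq_nonneg[OF g] by simp
  qed
  also have "\<dots> \<longleftrightarrow> (\<forall>f\<in>D. 2 * ip g f - ip f (A f) \<le> C\<^sup>2)"
    unfolding dual_norm_sq_def by (simp add: SUP_le_iff)
  finally show ?thesis .
qed

text \<open>
  The variational norm is the operator norm of \<open>f \<mapsto> \<langle>g, f\<rangle>\<close>: scaling \<open>f\<close> optimally, by
  \<open>\<langle>g, f\<rangle> / \<langle>f, A f\<rangle>\<close>, turns the bound on \<open>2 \<langle>g, f\<rangle> - \<langle>f, A f\<rangle>\<close> into a Cauchy-Schwarz inequality, and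
  the converse is the inequality \<open>2 a b \<le> a\<^sup>2 + b\<^sup>2\<close>. The norm properties of the dual norm are read
  off from this form.
\<close>

lemma dual_norm_le_iff:
  assumes g: "g \<in> W" and C: "C \<ge> 0"
  shows "dual_norm ip D A g \<le> ereal C \<longleftrightarrow> (\<forall>f\<in>D. \<bar>ip g f\<bar> \<le> C * sqrt (ip f (A f)))"
proof -
  have "(\<forall>f\<in>D. 2 * ip g f - ip f (A f) \<le> C\<^sup>2) \<longleftrightarrow> (\<forall>f\<in>D. \<bar>ip g f\<bar> \<le> C * sqrt (ip f (A f)))"
    (is "?L \<longleftrightarrow> ?R")
  proof
    assume L: ?L
    show ?R
    proof
      fix f assume f: "f \<in> D"
      have fW: "f \<in> W" using f dom by auto
      define b where "b = ip g f"
      define q where "q = ip f (A f)"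
      show "\<bar>ip g f\<bar> \<le> C * sqrt (ip f (A f))"
      proof (cases "f = 0")
        case True
        have "ip g 0 = 0"
          using ip_scale_right[OF subspace_0[OF subspace_W] g, of 0] by simp
        then show ?thesis using True energy_zero by simp
      next
        case False
        then have q: "q > 0" using pos f q_def by simp
        have "(b / q) *\<^sub>R f \<in> D" using f subspace_scale[OF subspace_D] by simp
        with L have "2 * ip g ((b / q) *\<^sub>R f) - ip ((b / q) *\<^sub>R f) (A ((b / q) *\<^sub>R f)) \<le> C\<^sup>2"
          by blast
        then have "2 * (b / q * b) - (b / q)\<^sup>2 * q \<le> C\<^sup>2"
          using energy_scale[OF f, of "b / q"] ip_scale_right[OF fW g, of "b / q"]
          by (simp add: b_def q_def)
        then have "b\<^sup>2 / q \<le> C\<^sup>2" using q by (simp add: power2_eq_square field_simps)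
        then have "b\<^sup>2 \<le> C\<^sup>2 * q" using q by (simp add: field_simps)
        then have "sqrt (b\<^sup>2) \<le> sqrt (C\<^sup>2 * q)" by (rule real_sqrt_le_mono)
        then show ?thesis using C by (simp add: real_sqrt_mult b_def q_def)
      qed
    qed
  next
    assume R: ?R
    show ?L
    proof
      fix f assume f: "f \<in> D"
      define s where "s = sqrt (ip f (A f))"
      have s2: "ip f (A f) = s\<^sup>2" using energy_nonneg[OF f] by (simp add: s_def)
      have "ip g f \<le> C * s" using R f unfolding s_def by (meson abs_le_D1)
      moreover have "2 * (C * s) \<le> C\<^sup>2 + s\<^sup>2" using sum_squares_bound[of C s] by simp
      ultimately show "2 * ip g f - ip f (A f) \<le> C\<^sup>2" using s2 by linarith
    qed
  qed
  then show ?thesis using dual_norm_le_iff_sq[OF g C] by simp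
qed

lemma dual_norm_add_le:
  assumes "f \<in> W" "k \<in> W" "a \<ge> 0" "b \<ge> 0"
    and "dual_norm ip D A f \<le> ereal a" "dual_norm ip D A k \<le> ereal b"
  shows "dual_norm ip D A (f + k) \<le> ereal (a + b)"
proof -
  have "\<bar>ip (f + k) l\<bar> \<le> (a + b) * sqrt (ip l (A l))" if l: "l \<in> D" for l
  proof -
    have "\<bar>ip f l\<bar> \<le> a * sqrt (ip l (A l))" "\<bar>ip k l\<bar> \<le> b * sqrt (ip l (A l))"
      using dual_norm_le_iff assms l by blast+
    then show ?thesis
      using ip_add_left[of f k l] assms l dom by (auto simp: algebra_simps)
  qed
  then show ?thesis
    using dual_norm_le_iff[of "f + k" "a + b"] assms subspace_add[OF subspace_W] by auto
qed

lemma dual_norm_scale_le: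
  assumes f: "f \<in> W" and a: "a \<ge> 0" and le: "dual_norm ip D A f \<le> ereal a"
  shows "dual_norm ip D A (c *\<^sub>R f) \<le> ereal (\<bar>c\<bar> * a)"
proof -
  have "\<bar>ip (c *\<^sub>R f) l\<bar> \<le> \<bar>c\<bar> * a * sqrt (ip l (A l))" if l: "l \<in> D" for l
  proof -
    have "\<bar>ip f l\<bar> \<le> a * sqrt (ip l (A l))"
      using dual_norm_le_iff[OF f a] le l by blast
    then have "\<bar>c\<bar> * \<bar>ip f l\<bar> \<le> \<bar>c\<bar> * (a * sqrt (ip l (A l)))" by (rule mult_left_mono) simp
    then show ?thesis using ip_scale_left[OF f, of l c] l dom by (auto simp: abs_mult mult.assoc)
  qed
  then show ?thesis
    using dual_norm_le_iff[of "c *\<^sub>R f" "\<bar>c\<bar> * a"] f a subspace_scale[OF subspace_W] by auto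
qed

text \<open>
  Minkowski's inequality: the form is not symmetric in general, but its symmetric part has the same
  quadratic form, and its Cauchy-Schwarz inequality follows from positivity at
  \<open>t f - s k\<close> where \<open>s\<close> and \<open>t\<close> are the norms of \<open>f\<close> and \<open>k\<close>.
\<close>

lemma energy_norm_triangle:
  assumes f: "f \<in> D" and k: "k \<in> D"
  shows "sqrt (ip (f + k) (A (f + k))) \<le> sqrt (ip f (A f)) + sqrt (ip k (A k))"
proof (cases "f = 0 \<or> k = 0")
  case True
  then show ?thesis using energy_zero energy_nonneg f k by auto
next
  case False
  define s where "s = sqrt (ip f (A f))"
  define t where "t = sqrt (ip k (A k))"
  define m where "m = ip f (A k) + ip k (A f)"
  have st: "s > 0" "t > 0" using False pos f k by (auto simp: s_def t_def)
  have s2: "ip f (A f) = s\<^sup>2" and t2: "ip k (A k) = t\<^sup>2"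
    using energy_nonneg f k by (auto simp: s_def t_def)
  have expand: "ip (a *\<^sub>R f + b *\<^sub>R k) (A (a *\<^sub>R f + b *\<^sub>R k)) = a\<^sup>2 * s\<^sup>2 + b\<^sup>2 * t\<^sup>2 + a * b * m" for a b
  proof -
    have D: "a *\<^sub>R f \<in> D" "b *\<^sub>R k \<in> D" using f k subspace_D by (auto simp: subspace_scale)
    have mem: "f \<in> W" "k \<in> W" "A f \<in> W" "A k \<in> W" using f k dom image by auto
    note sc = subspace_scale[OF subspace_W] subspace_add[OF subspace_W]
    show ?thesis
      using mem f k D
      by (simp add: A_add A_scale sc ip_add_left ip_add_right ip_scale_left ip_scale_right
          m_def s2 t2 algebra_simps power2_eq_square)
  qed
  have "t *\<^sub>R f + (- s) *\<^sub>R k \<in> D"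
    using f k subspace_D by (intro subspace_add subspace_scale)
  then have "0 \<le> t\<^sup>2 * s\<^sup>2 + (- s)\<^sup>2 * t\<^sup>2 + t * (- s) * m"
    using energy_nonneg expand[of t "- s"] by metis
  then have "(s * t) * m \<le> (s * t) * (2 * s * t)"
    by (simp add: power2_eq_square algebra_simps)
  then have m: "m \<le> 2 * s * t" using st by (simp add: mult_le_cancel_left)
  have "ip (f + k) (A (f + k)) \<le> (s + t)\<^sup>2"
    using expand[of 1 1] m by (simp add: power2_sum)
  then have "sqrt (ip (f + k) (A (f + k))) \<le> s + t"
    using st real_le_lsqrt[of "s + t"] by simp
  then show ?thesis by (simp add: s_def t_def)
qed

lemma energy_norm_le_dual_norm:
  assumes f: "f \<in> D" and C: "C \<ge> 0" and le: "dual_norm ip D A (A f) \<le> ereal C"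
  shows "sqrt (ip f (A f)) \<le> C"
proof -
  have "A f \<in> W" "f \<in> W" using f dom image by auto
  then have "2 * ip f (A f) - ip f (A f) \<le> C\<^sup>2"
    using dual_norm_le_iff_sq[of "A f" C] C le f ip_commute[of "A f" f] by auto
  then show ?thesis using real_le_lsqrt[of C] C by simp
qed

end

text \<open>
  Pairing \<open>A w\<close> with \<open>w\<close> gives \<open>\<langle>w, A w\<rangle> \<le> c \<langle>w, S w\<rangle>\<^sup>1\<^sup>/\<^sup>2 \<le> c \<langle>w, A w\<rangle>\<^sup>1\<^sup>/\<^sup>2\<close>, so the energy of \<open>w\<close>, which
  controls \<open>\<langle>h', w\<rangle>\<close>, is itself controlled by \<open>A w\<close>.
\<close>

lemma energy_estimate:
  assumes A: "positive_form W ip D A" and S: "positive_form W ip D S"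
    and le: "\<And>f. f \<in> D \<Longrightarrow> ip f (S f) \<le> ip f (A f)"
    and w: "w \<in> D" and C: "C \<ge> 0" and c: "c \<ge> 0" and h': "h' \<in> W"
    and norm_h': "dual_norm ip D S h' \<le> ereal C" and norm_Aw: "dual_norm ip D S (A w) \<le> ereal c"
  shows "\<bar>ip h' w\<bar> \<le> C * c"
proof -
  interpret A: positive_form W ip D A by fact
  interpret S: positive_form W ip D S by fact
  define s where "s = sqrt (ip w (S w))"
  define q where "q = sqrt (ip w (A w))"
  have sq: "s \<le> q" using le[OF w] by (simp add: s_def q_def)
  have q0: "q \<ge> 0" using A.energy_nonneg[OF w] by (simp add: q_def)
  have memW: "A w \<in> W" "w \<in> W" using w A.dom A.image by auto
  have "q\<^sup>2 = ip (A w) w"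
    using A.energy_nonneg[OF w] A.ip_commute memW by (simp add: q_def)
  also have "\<dots> \<le> c * s"
    using S.dual_norm_le_iff[OF memW(1) c] norm_Aw w unfolding s_def by (meson abs_le_D1)
  also have "\<dots> \<le> c * q" using sq c by (rule mult_left_mono)
  finally have "q \<le> c"
    using q0 c by (cases "q = 0") (auto simp: power2_eq_square)
  moreover have "\<bar>ip h' w\<bar> \<le> C * s"
    using S.dual_norm_le_iff[OF h' C] norm_h' w unfolding s_def by blast
  ultimately show ?thesis using mult_left_mono[of s c C] C sq by linarith
qed

text \<open>
  The test functions of \<open>L\<close> may be restricted to a core, because \<open>2 \<langle>u, f\<rangle> - \<langle>f, L f\<rangle>\<close> is a continuous
  function of the point \<open>(f, L f)\<close> of the graph.
\<close>

lemma dual_norm_antimono_core: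
  fixes L S0 :: "'a::real_inner \<Rightarrow> 'a"
  assumes L: "positive_form UNIV (\<bullet>) DL L" and S: "positive_form UNIV (\<bullet>) DS S0"
    and L_core: "is_core K DL L" and K: "K \<subseteq> DS"
    and le: "\<And>f. f \<in> DL \<inter> DS \<Longrightarrow> f \<bullet> S0 f \<le> f \<bullet> L f"
    and C: "C \<ge> 0" and norm_u: "dual_norm (\<bullet>) DS S0 u \<le> ereal C"
  shows "dual_norm (\<bullet>) DL L u \<le> ereal C"
proof -
  interpret L: positive_form UNIV "(\<bullet>)" DL L by fact
  interpret S: positive_form UNIV "(\<bullet>)" DS S0 by fact
  define F where "F = {p :: 'a \<times> 'a. 2 * (u \<bullet> fst p) - fst p \<bullet> snd p \<le> C\<^sup>2}"
  have "closed F" unfolding F_def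
    by (intro closed_Collect_le continuous_intros)
  moreover have "op_graph K L \<subseteq> F"
  proof
    fix p assume "p \<in> op_graph K L"
    then obtain f where f: "f \<in> K" and p: "p = (f, L f)" unfolding op_graph_def by auto
    have "f \<in> DL \<inter> DS" using f K L_core unfolding is_core_def by auto
    then have "2 * (u \<bullet> f) - f \<bullet> S0 f \<le> C\<^sup>2" "f \<bullet> S0 f \<le> f \<bullet> L f"
      using S.dual_norm_le_iff_sq[of u C] C norm_u le by auto
    then show "p \<in> F" unfolding F_def p by simp
  qed
  ultimately have "op_graph DL L \<subseteq> F"
    using L_core closure_minimal unfolding is_core_def by metis
  then show ?thesis
    using L.dual_norm_le_iff_sq[of u C] C by (auto simp: F_def op_graph_def)
qed


section \<open>Completions of seminormed spaces\<close>

lemma cauchy_seqsD: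
  assumes "x \<in> cauchy_seqs N S" "e > 0"
  shows "\<exists>M. \<forall>m\<ge>M. \<forall>n\<ge>M. N (x m - x n) < e"
proof -
  have "\<forall>e>0. \<exists>M. \<forall>m\<ge>M. \<forall>n\<ge>M. N (x m - x n) < e"
    using assms(1) unfolding cauchy_seqs_def mem_Collect_eq by (rule conjunct2)
  then show ?thesis using assms(2) by simp
qed

lemma completion_lift2_eqI:
  assumes x: "x \<in> X" and y: "y \<in> Y"
    and lim: "\<And>x y. x \<in> X \<Longrightarrow> y \<in> Y \<Longrightarrow> (\<lambda>k. F (x k) (y k)) \<longlonglongrightarrow> c"
  shows "completion_lift2 F X Y = c"
  unfolding completion_lift2_def
proof (rule the_equality)
  show "d = c" if "\<forall>x\<in>X. \<forall>y\<in>Y. (\<lambda>k. F (x k) (y k)) \<longlonglongrightarrow> d" for d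
    using that x y LIMSEQ_unique[OF _ lim[OF x y]] by blast
qed (use lim in blast)

text \<open>Homogeneity is asked for as an inequality; for \<open>c \<noteq> 0\<close> the inverse scalar gives the reverse one.\<close>

locale seminorm_on =
  fixes S :: "'a::real_vector set" and N :: "'a \<Rightarrow> real"
  assumes subspace: "subspace S"
    and triangle: "\<And>x y. x \<in> S \<Longrightarrow> y \<in> S \<Longrightarrow> N (x + y) \<le> N x + N y"
    and scale_le: "\<And>c x. x \<in> S \<Longrightarrow> N (c *\<^sub>R x) \<le> \<bar>c\<bar> * N x"
begin

lemma minus_commute: "x \<in> S \<Longrightarrow> y \<in> S \<Longrightarrow> N (x - y) = N (y - x)"
  using scale_le[of "x - y" "-1"] scale_le[of "y - x" "-1"] subspace_diff[OF subspace]
  by (simp add: antisym)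

lemma zero: "N 0 = 0"
  using triangle[of 0 0] scale_le[of 0 0] subspace_0[OF subspace] by simp

lemma nonneg: "x \<in> S \<Longrightarrow> N x \<ge> 0"
  using triangle[of x "- x"] minus_commute[of x 0] zero subspace_0[OF subspace]
    subspace_neg[OF subspace]
  by simp

lemma dist_triangle: "x \<in> S \<Longrightarrow> y \<in> S \<Longrightarrow> z \<in> S \<Longrightarrow> N (x - z) \<le> N (x - y) + N (y - z)"
  using triangle[of "x - y" "y - z"] subspace_diff[OF subspace] by simp

lemma diff_nonneg: "x \<in> S \<Longrightarrow> y \<in> S \<Longrightarrow> N (x - y) \<ge> 0"
  using nonneg subspace_diff[OF subspace] by simp

lemma cauchy_mem: "x \<in> cauchy_seqs N S \<Longrightarrow> x k \<in> S"
  unfolding cauchy_seqs_def by auto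

lemma const_cauchy: "a \<in> S \<Longrightarrow> (\<lambda>_. a) \<in> cauchy_seqs N S"
  unfolding cauchy_seqs_def using zero by auto

lemma null_diff_trans:
  assumes "\<And>k. x k \<in> S" "\<And>k. y k \<in> S" "\<And>k. z k \<in> S"
    and "(\<lambda>k. N (x k - y k)) \<longlonglongrightarrow> 0" "(\<lambda>k. N (y k - z k)) \<longlonglongrightarrow> 0"
  shows "(\<lambda>k. N (x k - z k)) \<longlonglongrightarrow> 0"
proof (rule tendsto_sandwich[OF _ _ tendsto_const])
  show "(\<lambda>k. N (x k - y k) + N (y k - z k)) \<longlonglongrightarrow> 0" using tendsto_add[OF assms(4,5)] by simp
qed (auto intro!: always_eventually dist_triangle diff_nonneg assms)

lemma null_diff_sym:
  assumes "\<And>k. x k \<in> S" "\<And>k. y k \<in> S" "(\<lambda>k. N (x k - y k)) \<longlonglongrightarrow> 0"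
  shows "(\<lambda>k. N (y k - x k)) \<longlonglongrightarrow> 0"
  using assms minus_commute by simp

lemma class_subsetI:
  assumes x: "x \<in> cauchy_seqs N S" and y: "y \<in> cauchy_seqs N S"
    and null: "(\<lambda>k. N (x k - y k)) \<longlonglongrightarrow> 0"
  shows "completion_rel N S `` {y} \<subseteq> completion_rel N S `` {x}"
proof
  fix z assume "z \<in> completion_rel N S `` {y}"
  then have z: "z \<in> cauchy_seqs N S" "(\<lambda>k. N (y k - z k)) \<longlonglongrightarrow> 0"
    unfolding completion_rel_def by blast+
  have "(\<lambda>k. N (x k - z k)) \<longlonglongrightarrow> 0"
    by (rule null_diff_trans[OF cauchy_mem[OF x] cauchy_mem[OF y] cauchy_mem[OF z(1)] null z(2)])
  then show "z \<in> completion_rel N S `` {x}" using x z(1) unfolding completion_rel_def by blast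
qed

lemma class_eqI:
  assumes x: "x \<in> cauchy_seqs N S" and y: "y \<in> cauchy_seqs N S"
    and null: "(\<lambda>k. N (x k - y k)) \<longlonglongrightarrow> 0"
  shows "completion_rel N S `` {x} = completion_rel N S `` {y}"
  using class_subsetI[OF x y null]
    class_subsetI[OF y x null_diff_sym[OF cauchy_mem[OF x] cauchy_mem[OF y] null]]
  by (rule subset_antisym[rotated])

lemma class_self: "x \<in> cauchy_seqs N S \<Longrightarrow> x \<in> completion_rel N S `` {x}"
  using zero unfolding completion_rel_def by simp

text \<open>Replacing both sequences by equivalent ones changes the distances by a null sequence.\<close>

lemma completion_dist_class:
  assumes x: "x \<in> cauchy_seqs N S" and y: "y \<in> cauchy_seqs N S"
    and lim: "(\<lambda>k. N (x k - y k)) \<longlonglongrightarrow> d"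
  shows "completion_dist N (completion_rel N S `` {x}) (completion_rel N S `` {y}) = d"
proof -
  have conv: "(\<lambda>k. N (x' k - y' k)) \<longlonglongrightarrow> d"
    if x': "x' \<in> completion_rel N S `` {x}" and y': "y' \<in> completion_rel N S `` {y}" for x' y'
  proof -
    have mem: "x k \<in> S" "y k \<in> S" "x' k \<in> S" "y' k \<in> S" for k
      using x' y' cauchy_mem unfolding completion_rel_def by blast+
    have null: "(\<lambda>k. N (x k - x' k) + N (y k - y' k)) \<longlonglongrightarrow> 0"
      using x' y' tendsto_add[of "\<lambda>k. N (x k - x' k)" 0 _ "\<lambda>k. N (y k - y' k)" 0]
      unfolding completion_rel_def by auto
    have "\<bar>N (x' k - y' k) - N (x k - y k)\<bar> \<le> N (x k - x' k) + N (y k - y' k)" for k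
    proof -
      have "N (x' k - y' k) \<le> N (x' k - x k) + (N (x k - y k) + N (y k - y' k))"
        using dist_triangle[OF mem(3)[of k] mem(1)[of k] mem(4)[of k]] dist_triangle[OF mem(1)[of k] mem(2)[of k] mem(4)[of k]] by simp
      moreover have "N (x k - y k) \<le> N (x k - x' k) + (N (x' k - y' k) + N (y' k - y k))"
        using dist_triangle[OF mem(1)[of k] mem(3)[of k] mem(2)[of k]] dist_triangle[OF mem(3)[of k] mem(4)[of k] mem(2)[of k]] by simp
      ultimately show ?thesis
        using minus_commute[OF mem(1)[of k] mem(3)[of k]] minus_commute[OF mem(2)[of k] mem(4)[of k]] by linarith
    qed
    then have "(\<lambda>k. N (x' k - y' k) - N (x k - y k)) \<longlonglongrightarrow> 0"
      by (intro Lim_null_comparison[OF _ null]) auto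
    from tendsto_add[OF this lim] show ?thesis by simp
  qed
  show ?thesis
    unfolding completion_dist_def
    by (rule completion_lift2_eqI[OF class_self[OF x] class_self[OF y]]) (rule conv)
qed

lemma completion_dist_embed:
  assumes a: "a \<in> S" and y: "y \<in> cauchy_seqs N S"
  shows "(\<lambda>k. N (a - y k)) \<longlonglongrightarrow> completion_dist N (completion_embed N S a) (completion_rel N S `` {y})"
proof -
  have "Cauchy (\<lambda>k. N (a - y k))"
  proof (rule metric_CauchyI)
    fix e :: real assume "e > 0"
    obtain M where M: "\<forall>m\<ge>M. \<forall>n\<ge>M. N (y m - y n) < e"
      using cauchy_seqsD[OF y \<open>e > 0\<close>] by (rule exE)
    have "\<bar>N (a - y m) - N (a - y n)\<bar> \<le> N (y m - y n)" for m n
      using dist_triangle[OF a cauchy_mem[OF y] cauchy_mem[OF y], of m n]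
        dist_triangle[OF a cauchy_mem[OF y] cauchy_mem[OF y], of n m]
        minus_commute[OF cauchy_mem[OF y] cauchy_mem[OF y], of m n] by linarith
    then have "dist (N (a - y m)) (N (a - y n)) < e" if "m \<ge> M" "n \<ge> M" for m n
      unfolding dist_real_def using that by (intro le_less_trans[OF _ M[rule_format]])
    then show "\<exists>M. \<forall>m\<ge>M. \<forall>n\<ge>M. dist (N (a - y m)) (N (a - y n)) < e" by blast
  qed
  then obtain d where d: "(\<lambda>k. N (a - y k)) \<longlonglongrightarrow> d"
    unfolding Cauchy_convergent_iff convergent_def by (rule exE)
  show ?thesis
    unfolding completion_embed_def completion_dist_class[OF const_cauchy[OF a] y d] by (rule d)
qed

lemma completion_limit_unique:
  assumes f: "\<And>k. f k \<in> S" and y: "y \<in> cauchy_seqs N S" and z: "z \<in> cauchy_seqs N S"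
    and lim_y: "(\<lambda>k. completion_dist N (completion_embed N S (f k)) (completion_rel N S `` {y})) \<longlonglongrightarrow> 0"
      (is "?dy \<longlonglongrightarrow> 0")
    and lim_z: "(\<lambda>k. completion_dist N (completion_embed N S (f k)) (completion_rel N S `` {z})) \<longlonglongrightarrow> 0"
      (is "?dz \<longlonglongrightarrow> 0")
  shows "completion_rel N S `` {y} = completion_rel N S `` {z}"
proof (rule class_eqI[OF y z], rule LIMSEQ_I)
  fix e :: real assume e: "e > 0"
  have "(\<lambda>k. ?dy k + ?dz k) \<longlonglongrightarrow> 0" using tendsto_add[OF lim_y lim_z] by simp
  then obtain j where j: "?dy j + ?dz j < e"
    using order_tendstoD(2)[of _ 0 sequentially e] e unfolding eventually_sequentially by blast
  have "(\<lambda>k. N (f j - y k) + N (f j - z k)) \<longlonglongrightarrow> ?dy j + ?dz j"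
    by (intro tendsto_add completion_dist_embed f y z)
  then have "\<forall>\<^sub>F k in sequentially. N (f j - y k) + N (f j - z k) < e"
    using j by (rule order_tendstoD)
  then obtain K where K: "\<And>k. k \<ge> K \<Longrightarrow> N (f j - y k) + N (f j - z k) < e"
    unfolding eventually_sequentially by blast
  have "norm (N (y k - z k) - 0) < e" if "k \<ge> K" for k
    using K[OF that] dist_triangle[of "y k" "f j" "z k"] minus_commute[of "y k" "f j"]
      diff_nonneg[of "y k" "z k"] f cauchy_mem[OF y] cauchy_mem[OF z] by simp
  then show "\<exists>K. \<forall>k\<ge>K. norm (N (y k - z k) - 0) < e" by blast
qed

lemma cauchy_bounded:
  assumes y: "y \<in> cauchy_seqs N S"
  obtains B where "B \<ge> 0" "\<And>k. N (y k) \<le> B"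
proof -
  note y_S = cauchy_mem[OF y] and zero_S = subspace_0[OF subspace]
  have "Bseq (\<lambda>k. N (0 - y k))"
    using convergentI[OF completion_dist_embed[OF zero_S y]] by (rule convergent_imp_Bseq)
  then obtain B where B: "B > 0" "\<And>k. norm (N (0 - y k)) \<le> B" by (rule BseqE) blast
  have "N (y k) \<le> B" for k
    using B(2)[of k] minus_commute[OF zero_S y_S[of k]] by simp
  then show ?thesis using that[of B] B(1) by simp
qed

end


section \<open>The Sobolev spaces of a positive operator\<close>

lemma positive_formI:
  fixes A :: "'a::real_inner \<Rightarrow> 'a"
  assumes "linear_operator D A" "positive_operator D A"
  shows "positive_form UNIV (\<bullet>) D A"
proof
  show "inner_product_on UNIV ((\<bullet>) :: 'a \<Rightarrow> 'a \<Rightarrow> real)"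
    unfolding inner_product_on_def
    by (intro conjI ballI allI) (simp_all add: inner_add_left, simp add: inner_commute)
qed (use assms in \<open>auto simp: positive_operator_def\<close>)

lemma seminorm_norm_1:
  fixes A :: "'a::real_inner \<Rightarrow> 'a"
  assumes "positive_form UNIV (\<bullet>) D A"
  shows "seminorm_on D (norm_1 D A)"
proof -
  interpret positive_form UNIV "(\<bullet>)" D A by fact
  show ?thesis
  proof
    show "norm_1 D A (c *\<^sub>R f) \<le> \<bar>c\<bar> * norm_1 D A f" if "f \<in> D" for c f
      using energy_scale[OF that, of c] by (simp add: norm_1_def real_sqrt_mult)
  qed (auto simp: norm_1_def subspace_D energy_norm_triangle)
qed

lemma dual_norm_eq_norm_m1:
  assumes "positive_form UNIV (\<bullet>) D A" and "g \<in> finite_dual D A"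
  shows "dual_norm (\<bullet>) D A g = ereal (norm_m1 D A g)" "norm_m1 D A g \<ge> 0"
proof -
  interpret positive_form UNIV "(\<bullet>)" D A by fact
  have "0 \<le> dual_norm (\<bullet>) D A g" using dual_norm_nonneg by simp
  then show "dual_norm (\<bullet>) D A g = ereal (norm_m1 D A g)" "norm_m1 D A g \<ge> 0"
    using assms(2) unfolding finite_dual_def norm_m1_def
    by (auto simp: ereal_real real_of_ereal_pos)
qed

lemma norm_m1_le:
  assumes A: "positive_form UNIV (\<bullet>) D A" and le: "dual_norm (\<bullet>) D A g \<le> ereal C"
  shows "g \<in> finite_dual D A" "norm_m1 D A g \<le> C"
proof -
  show fin: "g \<in> finite_dual D A"
    using le unfolding finite_dual_def by (auto intro: le_less_trans)
  show "norm_m1 D A g \<le> C" using le dual_norm_eq_norm_m1(1)[OF A fin] by simp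
qed

lemma seminorm_norm_m1:
  fixes A :: "'a::real_inner \<Rightarrow> 'a"
  assumes A: "positive_form UNIV (\<bullet>) D A"
  shows "seminorm_on (finite_dual D A) (norm_m1 D A)"
proof -
  interpret positive_form UNIV "(\<bullet>)" D A by fact
  note eq = dual_norm_eq_norm_m1[OF A]
  have add: "dual_norm (\<bullet>) D A (x + y) \<le> ereal (norm_m1 D A x + norm_m1 D A y)"
    if "x \<in> finite_dual D A" "y \<in> finite_dual D A" for x y
    using dual_norm_add_le[of x y "norm_m1 D A x" "norm_m1 D A y"] eq that by simp
  have scale: "dual_norm (\<bullet>) D A (c *\<^sub>R x) \<le> ereal (\<bar>c\<bar> * norm_m1 D A x)"
    if "x \<in> finite_dual D A" for c x
    using dual_norm_scale_le[of x "norm_m1 D A x" c] eq that by simp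
  have zero: "0 \<in> finite_dual D A"
    using dual_norm_le_iff[of 0 0] norm_m1_le(1)[OF A, of 0 0] by simp
  note bound_add = norm_m1_le[OF A add] and bound_scale = norm_m1_le[OF A scale]
  show ?thesis
    by unfold_locales (use zero bound_add bound_scale in \<open>simp_all add: subspace_def\<close>)
qed

lemma inner_le_norms:
  fixes A :: "'a::real_inner \<Rightarrow> 'a"
  assumes A: "positive_form UNIV (\<bullet>) D A" and g: "g \<in> finite_dual D A" and f: "f \<in> D"
  shows "\<bar>g \<bullet> f\<bar> \<le> norm_m1 D A g * norm_1 D A f"
proof -
  interpret positive_form UNIV "(\<bullet>)" D A by fact
  show ?thesis
    using dual_norm_le_iff[of g "norm_m1 D A g"] dual_norm_eq_norm_m1[OF A g] f
    unfolding norm_1_def by simp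
qed

lemma norm_1_le_norm_m1:
  fixes A :: "'a::real_inner \<Rightarrow> 'a"
  assumes A: "positive_form UNIV (\<bullet>) D A" and f: "f \<in> D" and Af: "A f \<in> finite_dual D A"
  shows "norm_1 D A f \<le> norm_m1 D A (A f)"
  using positive_form.energy_norm_le_dual_norm[OF A f] dual_norm_eq_norm_m1[OF A Af]
  unfolding norm_1_def by simp

text \<open>
  The extended inverse is determined by any single sequence whose image converges: the bound
  \<open>\<parallel>f - f'\<parallel>\<^sub>1 \<le> \<parallel>A f - A f'\<parallel>\<^sub>-\<^sub>1\<close> makes that sequence Cauchy and merges it with every other one.
\<close>

lemma ext_inverse_eq_class:
  fixes A :: "'a::real_inner \<Rightarrow> 'a"
  assumes A: "positive_form UNIV (\<bullet>) D A" and h: "h \<in> finite_dual D A"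
    and f: "\<And>k. f k \<in> D" and Af: "\<And>k. A (f k) \<in> finite_dual D A"
    and lim: "(\<lambda>k. norm_m1 D A (A (f k) - h)) \<longlonglongrightarrow> 0"
  shows "f \<in> cauchy_seqs (norm_1 D A) D"
    and "ext_inverse D A (embm1 D A h) = completion_rel (norm_1 D A) D `` {f}"
proof -
  interpret positive_form UNIV "(\<bullet>)" D A by fact
  interpret N1: seminorm_on D "norm_1 D A" by (rule seminorm_norm_1[OF A])
  interpret M: seminorm_on "finite_dual D A" "norm_m1 D A" by (rule seminorm_norm_m1[OF A])
  have bound: "norm_1 D A (x - y) \<le> norm_m1 D A (A x - h) + norm_m1 D A (A y - h)"
    if "x \<in> D" "y \<in> D" "A x \<in> finite_dual D A" "A y \<in> finite_dual D A" for x y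
  proof -
    have "norm_1 D A (x - y) \<le> norm_m1 D A (A x - A y)"
      using norm_1_le_norm_m1[OF A, of "x - y"] that subspace_diff[OF subspace_D]
        subspace_diff[OF M.subspace] A_diff by simp
    also have "\<dots> \<le> norm_m1 D A (A x - h) + norm_m1 D A (A y - h)"
      using M.dist_triangle[of "A x" h "A y"] M.minus_commute[of h "A y"] that h by simp
    finally show ?thesis .
  qed
  show cauchy: "f \<in> cauchy_seqs (norm_1 D A) D"
    unfolding cauchy_seqs_def
  proof (intro CollectI conjI allI impI)
    show "range f \<subseteq> D" using f by auto
    fix e :: real assume "e > 0"
    then have "\<forall>\<^sub>F k in sequentially. norm_m1 D A (A (f k) - h) < e / 2"
      using order_tendstoD(2)[OF lim, of "e / 2"] by simp
    then obtain K where K: "\<And>k. k \<ge> K \<Longrightarrow> norm_m1 D A (A (f k) - h) < e / 2"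
      unfolding eventually_sequentially by blast
    have "norm_1 D A (f m - f n) < e" if "m \<ge> K" "n \<ge> K" for m n
      using bound[OF f f Af Af, of m n] K[OF that(1)] K[OF that(2)] by simp
    then show "\<exists>K. \<forall>m\<ge>K. \<forall>n\<ge>K. norm_1 D A (f m - f n) < e" by blast
  qed
  have dist_h: "distm1 D A (embm1 D A a) (embm1 D A h) = norm_m1 D A (a - h)"
    if "a \<in> finite_dual D A" for a
    unfolding distm1_def embm1_def completion_embed_def
    by (rule M.completion_dist_class) (use that h M.const_cauchy in auto)
  let ?Y = "completion_rel (norm_1 D A) D `` {f}"
  have converges: "(\<lambda>k. dist1 D A (emb1 D A (x k)) ?Y) \<longlonglongrightarrow> 0"
    if x: "\<And>k. x k \<in> D" "\<And>k. A (x k) \<in> finite_dual D A"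
      and lim_x: "(\<lambda>k. distm1 D A (embm1 D A (A (x k))) (embm1 D A h)) \<longlonglongrightarrow> 0" for x
  proof -
    have lim_x': "(\<lambda>k. norm_m1 D A (A (x k) - h)) \<longlonglongrightarrow> 0" using lim_x dist_h x by simp
    have d: "(\<lambda>j. norm_1 D A (x k - f j)) \<longlonglongrightarrow> dist1 D A (emb1 D A (x k)) ?Y" for k
      unfolding dist1_def emb1_def by (rule N1.completion_dist_embed[OF x(1) cauchy])
    have le: "dist1 D A (emb1 D A (x k)) ?Y \<le> norm_m1 D A (A (x k) - h)" for k
    proof (rule LIMSEQ_le[OF d])
      show "(\<lambda>j. norm_m1 D A (A (x k) - h) + norm_m1 D A (A (f j) - h))
          \<longlonglongrightarrow> norm_m1 D A (A (x k) - h)"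
        using tendsto_add[OF tendsto_const lim] by simp
    qed (use bound x f Af in blast)
    have ge: "0 \<le> dist1 D A (emb1 D A (x k)) ?Y" for k
      by (rule LIMSEQ_le_const[OF d]) (use N1.diff_nonneg x f in blast)
    show ?thesis
      by (rule tendsto_sandwich[OF _ _ tendsto_const lim_x']) (use le ge in auto)
  qed
  have lim_f: "(\<lambda>k. distm1 D A (embm1 D A (A (f k))) (embm1 D A h)) \<longlonglongrightarrow> 0"
    using lim dist_h Af by simp
  show "ext_inverse D A (embm1 D A h) = ?Y"
    unfolding ext_inverse_def
  proof (rule the_equality)
    show "?Y \<in> H1 D A \<and> (\<forall>x. (\<forall>k. x k \<in> D \<and> A (x k) \<in> finite_dual D A) \<and>
        (\<lambda>k. distm1 D A (embm1 D A (A (x k))) (embm1 D A h)) \<longlonglongrightarrow> 0 \<longrightarrow>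
        (\<lambda>k. dist1 D A (emb1 D A (x k)) ?Y) \<longlonglongrightarrow> 0)"
      using converges cauchy unfolding H1_def completion_def by (auto intro: quotientI)
  next
    fix Z
    assume Z: "Z \<in> H1 D A \<and> (\<forall>x. (\<forall>k. x k \<in> D \<and> A (x k) \<in> finite_dual D A) \<and>
        (\<lambda>k. distm1 D A (embm1 D A (A (x k))) (embm1 D A h)) \<longlonglongrightarrow> 0 \<longrightarrow>
        (\<lambda>k. dist1 D A (emb1 D A (x k)) Z) \<longlonglongrightarrow> 0)"
    then obtain z where z: "z \<in> cauchy_seqs (norm_1 D A) D"
      and Z_eq: "Z = completion_rel (norm_1 D A) D `` {z}"
      unfolding H1_def completion_def by (auto elim: quotientE)
    have lim_Z: "(\<lambda>k. dist1 D A (emb1 D A (f k)) Z) \<longlonglongrightarrow> 0" using Z lim_f f Af by blast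
    have lim_Y: "(\<lambda>k. dist1 D A (emb1 D A (f k)) ?Y) \<longlonglongrightarrow> 0" by (rule converges[OF f Af lim_f])
    show "Z = ?Y"
      using lim_Z lim_Y unfolding dist1_def emb1_def Z_eq
      by (rule N1.completion_limit_unique[where f = f, OF f z cauchy])
  qed
qed

text \<open>
  Independence of representatives comes from
  \<open>\<langle>x, y\<rangle> - \<langle>g, f\<rangle> = \<langle>x - g, y\<rangle> + \<langle>g, y - f\<rangle>\<close> and the boundedness of Cauchy sequences.
\<close>

lemma pairing_embed_class:
  fixes A :: "'a::real_inner \<Rightarrow> 'a"
  assumes A: "positive_form UNIV (\<bullet>) D A" and g: "g \<in> finite_dual D A"
    and f: "f \<in> cauchy_seqs (norm_1 D A) D"
  shows "(\<lambda>k. g \<bullet> f k) \<longlonglongrightarrow> pairing (embm1 D A g) (completion_rel (norm_1 D A) D `` {f})"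
proof -
  interpret N1: seminorm_on D "norm_1 D A" by (rule seminorm_norm_1[OF A])
  interpret M: seminorm_on "finite_dual D A" "norm_m1 D A" by (rule seminorm_norm_m1[OF A])
  note CS = inner_le_norms[OF A]
  note fD = N1.cauchy_mem[OF f]
  define C where "C = norm_m1 D A g + 1"
  have C: "C > 0" "norm_m1 D A g \<le> C" using M.nonneg[OF g] by (auto simp: C_def)
  have "Cauchy (\<lambda>k. g \<bullet> f k)"
  proof (rule metric_CauchyI)
    fix e :: real assume "e > 0"
    then have "e / C > 0" using C by simp
    then obtain K where K: "\<forall>m\<ge>K. \<forall>n\<ge>K. norm_1 D A (f m - f n) < e / C"
      using cauchy_seqsD[OF f] by blast
    have "dist (g \<bullet> f m) (g \<bullet> f n) < e" if "m \<ge> K" "n \<ge> K" for m n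
    proof -
      have mem: "f m - f n \<in> D" using fD subspace_diff[OF N1.subspace] by simp
      have "dist (g \<bullet> f m) (g \<bullet> f n) = \<bar>g \<bullet> (f m - f n)\<bar>"
        by (simp add: dist_real_def inner_diff_right)
      also have "\<dots> \<le> norm_m1 D A g * norm_1 D A (f m - f n)" by (rule CS[OF g mem])
      also have "\<dots> \<le> C * norm_1 D A (f m - f n)"
        using C N1.nonneg[OF mem] by (simp add: mult_right_mono)
      also have "\<dots> < e" using K[rule_format, OF that] C by (simp add: field_simps)
      finally show ?thesis .
    qed
    then show "\<exists>K. \<forall>m\<ge>K. \<forall>n\<ge>K. dist (g \<bullet> f m) (g \<bullet> f n) < e" by blast
  qed
  then obtain c where c: "(\<lambda>k. g \<bullet> f k) \<longlonglongrightarrow> c"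
    unfolding Cauchy_convergent_iff convergent_def by (rule exE)
  let ?X = "embm1 D A g" and ?Y = "completion_rel (norm_1 D A) D `` {f}"
  have conv: "(\<lambda>k. x k \<bullet> y k) \<longlonglongrightarrow> c" if x: "x \<in> ?X" and y: "y \<in> ?Y" for x y
  proof -
    have xS: "x k \<in> finite_dual D A" for k
      using x M.cauchy_mem unfolding embm1_def completion_embed_def completion_rel_def by auto
    have x_lim: "(\<lambda>k. norm_m1 D A (x k - g)) \<longlonglongrightarrow> 0"
      using x M.minus_commute[OF xS g]
      unfolding embm1_def completion_embed_def completion_rel_def by auto
    have y_c: "y \<in> cauchy_seqs (norm_1 D A) D" using y unfolding completion_rel_def by auto
    note yD = N1.cauchy_mem[OF y_c]
    have y_lim: "(\<lambda>k. norm_1 D A (y k - f k)) \<longlonglongrightarrow> 0"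
      using y N1.minus_commute[OF yD fD] unfolding completion_rel_def by auto
    obtain B where B: "B \<ge> 0" "\<And>k. norm_1 D A (y k) \<le> B" using N1.cauchy_bounded[OF y_c] by blast
    have le: "\<bar>x k \<bullet> y k - g \<bullet> f k\<bar>
        \<le> norm_m1 D A (x k - g) * B + norm_m1 D A g * norm_1 D A (y k - f k)" for k
    proof -
      have mem: "x k - g \<in> finite_dual D A" "y k - f k \<in> D"
        using xS g yD fD subspace_diff[OF N1.subspace] subspace_diff[OF M.subspace] by auto
      have "x k \<bullet> y k - g \<bullet> f k = (x k - g) \<bullet> y k + g \<bullet> (y k - f k)"
        by (simp add: inner_diff_left inner_diff_right)
      moreover have "\<bar>(x k - g) \<bullet> y k\<bar> \<le> norm_m1 D A (x k - g) * B"
        using CS[OF mem(1) yD] mult_left_mono[OF B(2) M.nonneg[OF mem(1)]] order_trans by blast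
      moreover have "\<bar>g \<bullet> (y k - f k)\<bar> \<le> norm_m1 D A g * norm_1 D A (y k - f k)"
        by (rule CS[OF g mem(2)])
      ultimately show ?thesis by linarith
    qed
    have null: "(\<lambda>k. norm_m1 D A (x k - g) * B + norm_m1 D A g * norm_1 D A (y k - f k)) \<longlonglongrightarrow> 0"
      using tendsto_add[OF tendsto_mult_left_zero[OF x_lim] tendsto_mult_right_zero[OF y_lim]]
      by simp
    have "(\<lambda>k. x k \<bullet> y k - g \<bullet> f k) \<longlonglongrightarrow> 0"
      by (rule Lim_null_comparison[OF always_eventually null]) (simp add: le)
    from tendsto_add[OF this c] show ?thesis by simp
  qed
  have "(\<lambda>_. g) \<in> ?X"
    using M.class_self[OF M.const_cauchy[OF g]] unfolding embm1_def completion_embed_def .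
  then have "pairing ?X ?Y = c"
    unfolding pairing_def by (rule completion_lift2_eqI[OF _ N1.class_self[OF f]]) (rule conv)
  then show ?thesis using c by simp
qed


section \<open>Finite approximations\<close>

lemma finite_approximation_positive_form:
  assumes "finite_dim_subspace (H n)" "inner_product_on (H n) (ip n)"
    and "finite_approximation H ip D A An"
  shows "positive_form (H n) (ip n) (H n) (An n)"
  using assms unfolding finite_approximation_def finite_dim_subspace_def
  by unfold_locales auto

text \<open>The injectivity needed for the inverse of \<open>A\<^sub>n\<close> is its positivity.\<close>

lemma finite_approximation_inverse:
  assumes fin: "finite_dim_subspace (H n)" and ip: "inner_product_on (H n) (ip n)"
    and approx: "finite_approximation H ip D A An" and h: "h \<in> H n"
  shows "inv_into (H n) (An n) h \<in> H n" "An n (inv_into (H n) (An n) h) = h"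
proof -
  interpret positive_form "H n" "ip n" "H n" "An n"
    by (rule finite_approximation_positive_form[OF assms(1-3)])
  have "x = 0" if x: "x \<in> H n" and "An n x = 0" for x
  proof -
    have "ip n x 0 = 0"
      using ip_scale_right[OF subspace_0[OF subspace_W] x, of 0] by simp
    then show ?thesis using that pos[OF x] by auto
  qed
  then have "An n ` H n = H n"
    using injective_endomorphism_surjective[OF fin lin image] by blast
  then show "inv_into (H n) (An n) h \<in> H n" "An n (inv_into (H n) (An n) h) = h"
    using h by (auto intro: inv_into_into f_inv_into_f)
qed

lemma finite_approximation_eventually:
  assumes "finite_approximation H ip D A An" "f \<in> Loc H"
  shows "\<forall>\<^sub>F n in sequentially. f \<in> H n \<and> An n f = A f"
  using assms unfolding finite_approximation_def eventually_sequentially by blast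


section \<open>Convergence of the approximations\<close>

theorem theorem2:
  fixes H :: "nat \<Rightarrow> 'a::{real_inner, complete_space} set"
    and ip :: "nat \<Rightarrow> 'a \<Rightarrow> 'a \<Rightarrow> real"
    and DL DS :: "'a set"
    and L S0 :: "'a \<Rightarrow> 'a"
    and Ln S0n :: "nat \<Rightarrow> 'a \<Rightarrow> 'a"
    and h h' :: 'a
    and g :: "real \<Rightarrow> 'a"
  assumes H_fin: "\<And>n. finite_dim_subspace (H n)"
    and H_inc: "incseq H"
    and ip_inner: "\<And>n. inner_product_on (H n) (ip n)"
    and ip_lim: "\<And>f1 f2. f1 \<in> Loc H \<Longrightarrow> f2 \<in> Loc H \<Longrightarrow> (\<lambda>n. ip n f1 f2) \<longlonglongrightarrow> f1 \<bullet> f2"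
    and L_lin: "linear_operator DL L"
    and L_dense: "densely_defined DL"
    and L_pos: "positive_operator DL L"
    and L_closed: "closed_operator DL L"
    and L_core: "is_core (Loc H) DL L"
    and Ladj_core: "is_core (Loc H) (adjoint_dom DL L) (adjoint_op DL L)"
    and Ln_approx: "finite_approximation H ip DL L Ln"
    and S_lin: "linear_operator DS S0"
    and S_sym: "symmetric_operator DS S0"
    and S_pos: "positive_operator DS S0"
    and S_core: "is_core (Loc H) DS S0"
    and S_le_L: "\<And>f. f \<in> DL \<inter> DS \<Longrightarrow> f \<bullet> S0 f \<le> f \<bullet> L f"
    and Sn_approx: "finite_approximation H ip DS S0 S0n"
    and Sn_le_Ln: "\<And>n f. f \<in> H n \<Longrightarrow> ip n f (S0n n f) \<le> ip n f (Ln n f)"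
    and h: "h \<in> Loc H \<inter> finite_dual DL L"
    and h': "h' \<in> Loc H \<inter> finite_dual DL L"
    and h_closure: "embm1 DL L h \<in> image_closure DL L"
    and A_Loc: "\<And>\<epsilon>. \<epsilon> > 0 \<Longrightarrow> g \<epsilon> \<in> Loc H"
    and A_approx: "\<And>\<epsilon>. \<epsilon> > 0 \<Longrightarrow> dual_norm (\<bullet>) DS S0 (h - L (g \<epsilon>)) < ereal \<epsilon>"
    and B_fin: "dual_norm (\<bullet>) DS S0 h' < \<infinity>"
    and B_h': "(\<lambda>n. dual_norm (ip n) (H n) (S0n n) h') \<longlonglongrightarrow> dual_norm (\<bullet>) DS S0 h'"
    and B_u: "\<And>\<epsilon>. \<epsilon> > 0 \<Longrightarrow>
      (\<lambda>n. dual_norm (ip n) (H n) (S0n n) (h - L (g \<epsilon>))) \<longlonglongrightarrow> dual_norm (\<bullet>) DS S0 (h - L (g \<epsilon>))"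
  shows "(\<lambda>n. ip n h' (inv_into (H n) (Ln n) h)) \<longlonglongrightarrow>
    pairing (embm1 DL L h') (ext_inverse DL L (embm1 DL L h))"
proof -
  have L: "positive_form UNIV (\<bullet>) DL L" by (rule positive_formI[OF L_lin L_pos])
  have S: "positive_form UNIV (\<bullet>) DS S0" by (rule positive_formI[OF S_lin S_pos])
  have LocD: "Loc H \<subseteq> DL" "Loc H \<subseteq> DS" using L_core S_core unfolding is_core_def by auto
  have hL: "h \<in> Loc H" "h \<in> finite_dual DL L" and hL': "h' \<in> Loc H" "h' \<in> finite_dual DL L"
    using h h' by auto
  interpret M: seminorm_on "finite_dual DL L" "norm_m1 DL L" by (rule seminorm_norm_m1[OF L])
  \<comment> \<open>\<open>\<epsilon>\<close> runs through \<open>1, 1/2, 1/3, \<dots>\<close>, since elements of \<open>\<H>\<^sub>1\<close> are classes of sequences\<close>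
  define \<delta> where "\<delta> k = 1 / real (Suc k)" for k
  define f where "f k = g (\<delta> k)" for k
  define u where "u k = h - L (f k)" for k
  have \<delta>: "\<delta> k > 0" for k by (simp add: \<delta>_def)
  have \<delta>_lim: "\<delta> \<longlonglongrightarrow> 0" unfolding \<delta>_def using LIMSEQ_Suc[OF lim_1_over_n] by simp
  have fLoc: "f k \<in> Loc H" for k using A_Loc[OF \<delta>] by (simp add: f_def)
  have fD: "f k \<in> DL" for k using fLoc LocD by auto
  have u_small: "dual_norm (\<bullet>) DS S0 (u k) < ereal (\<delta> k)" for k
    using A_approx[OF \<delta>] by (simp add: f_def u_def)
  have u_lim: "(\<lambda>n. dual_norm (ip n) (H n) (S0n n) (u k)) \<longlonglongrightarrow> dual_norm (\<bullet>) DS S0 (u k)" for k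
    using B_u[OF \<delta>] by (simp add: f_def u_def)

  have "dual_norm (\<bullet>) DL L (u k) \<le> ereal (\<delta> k)" for k
    using dual_norm_antimono_core[OF L S L_core LocD(2) S_le_L less_imp_le[OF \<delta>]
        less_imp_le[OF u_small]] .
  note u_m1 = norm_m1_le[OF L this]
  have Lf: "L (f k) \<in> finite_dual DL L" for k
    using subspace_diff[OF M.subspace hL(2) u_m1(1)[of k]] by (simp add: u_def)
  have "(\<lambda>k. norm_m1 DL L (L (f k) - h)) \<longlonglongrightarrow> 0"
  proof (rule tendsto_sandwich[OF _ _ tendsto_const \<delta>_lim])
    show "\<forall>\<^sub>F k in sequentially. norm_m1 DL L (L (f k) - h) \<le> \<delta> k"
      using u_m1(2) M.minus_commute[OF Lf hL(2)] by (simp add: u_def)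
  qed (use M.diff_nonneg[OF Lf hL(2)] in simp)
  note ext = ext_inverse_eq_class[OF L hL(2) fD Lf this]
  define c where "c = pairing (embm1 DL L h') (ext_inverse DL L (embm1 DL L h))"
  have c: "(\<lambda>k. h' \<bullet> f k) \<longlonglongrightarrow> c"
    using pairing_embed_class[OF L hL'(2) ext(1)] ext(2) by (simp add: c_def)

  have "dual_norm (\<bullet>) DS S0 h' \<ge> 0" by (rule positive_form.dual_norm_nonneg[OF S UNIV_I])
  then obtain C where C: "C > 0" "dual_norm (\<bullet>) DS S0 h' < ereal C"
    using B_fin by (metis ereal_dense2 ereal_less(2) le_less_trans)

  have "(\<lambda>n. ip n h' (inv_into (H n) (Ln n) h)) \<longlonglongrightarrow> c"
  proof (rule tendstoI)
    fix e :: real assume e: "e > 0"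
    have "\<forall>\<^sub>F k in sequentially. C * \<delta> k < e / 3"
      using order_tendstoD(2)[OF tendsto_mult_right_zero[OF \<delta>_lim, of C], of "e / 3"] e by simp
    moreover have "\<forall>\<^sub>F k in sequentially. dist (h' \<bullet> f k) c < e / 3"
      using tendstoD[OF c, of "e / 3"] e by simp
    ultimately obtain k where k: "C * \<delta> k < e / 3" "dist (h' \<bullet> f k) c < e / 3"
      using eventually_happens[OF eventually_conj] by fastforce
    \<comment> \<open>\<open>k\<close> is now fixed, and only \<open>n\<close> grows\<close>
    have ev1: "\<forall>\<^sub>F n in sequentially. dist (ip n h' (f k)) (h' \<bullet> f k) < e / 3"
      using tendstoD[OF ip_lim[OF hL'(1) fLoc], of "e / 3"] e by simp
    \<comment> \<open>the strict bounds on the limiting norms pass to the norms on \<open>H\<^sub>n\<close> for large \<open>n\<close>\<close>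
    have ev2: "\<forall>\<^sub>F n in sequentially. dual_norm (ip n) (H n) (S0n n) h' < ereal C"
      using order_tendstoD(2)[OF B_h' C(2)] .
    have ev3: "\<forall>\<^sub>F n in sequentially. dual_norm (ip n) (H n) (S0n n) (u k) < ereal (\<delta> k)"
      using order_tendstoD(2)[OF u_lim u_small] .
    note ev = finite_approximation_eventually[OF Ln_approx]
    show "\<forall>\<^sub>F n in sequentially. dist (ip n h' (inv_into (H n) (Ln n) h)) c < e"
      using ev1 ev2 ev3 ev[OF hL(1)] ev[OF hL'(1)] ev[OF fLoc[of k]]
    proof eventually_elim
      case (elim n)
      interpret Ln: positive_form "H n" "ip n" "H n" "Ln n"
        by (rule finite_approximation_positive_form[OF H_fin ip_inner Ln_approx])
      interpret Sn: positive_form "H n" "ip n" "H n" "S0n n"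
        by (rule finite_approximation_positive_form[OF H_fin ip_inner Sn_approx])
      define F where "F = inv_into (H n) (Ln n) h"
      have F: "F \<in> H n" "Ln n F = h"
        using finite_approximation_inverse[OF H_fin ip_inner Ln_approx] elim
        by (auto simp: F_def)
      define w where "w = F - f k"
      have w: "w \<in> H n" using F elim subspace_diff[OF Ln.subspace_W] by (simp add: w_def)
      have "Ln n w = u k" using F elim Ln.A_diff by (simp add: w_def u_def)
      then have "\<bar>ip n h' w\<bar> \<le> C * \<delta> k"
        using energy_estimate[OF Ln.positive_form_axioms Sn.positive_form_axioms Sn_le_Ln w]
          elim C \<delta>[of k] by (simp add: less_imp_le)
      moreover have "ip n h' F = ip n h' (f k) + ip n h' w"
        using Ln.ip_add_right[of "f k" w h'] w elim by (simp add: w_def)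
      ultimately show ?case
        using elim(1) k unfolding F_def dist_real_def by linarith
    qed
  qed
  then show ?thesis by (simp add: c_def)
qed

end
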